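(* Let $X$ be an infinite compact Hausdorff topological space whose weight is smaller than the splitting number $\mathfrak{s}$. Then $X$ contains a non-trivial convergent sequence: there exist a sequence $(a_n)_{n<\omega}$ of points of $X$ that is not eventually constant and a point $a\in X$ such that $a_n\to a$.
   Context: The weight of a topological space is the minimal cardinality of a base of its topology. For infinite sets $A,B\subseteq\omega$, $A$ splits $B$ if both $B\cap A$ and $B\setminus A$ are infinite. A family $\mathcal{A}$ of infinite subsets of $\omega$ is splitting if for every infinite $B\subseteq\omega$ there is $A\in\mathcal{A}$ which splits $B$. The splitting number $\mathfrak{s}$ is the smallest cardinality of a splitting family. A sequence $(a_n)$ converges to $a$ if every open neighbourhood of $a$ contains all but finitely many terms of the sequence. A sequence is trivial if it is eventually constant, and non-trivial otherwise. *)

theory Defs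
  imports "HOL-Analysis.Analysis"
begin

unbundle cardinal_syntax

text \<open>
  The least cardinality of a member of a family of sets. Cardinals are those of the library
  (well-order relations, compared by \<open>\<le>o\<close> and \<open><o\<close>), so the value is determined up to \<open>=o\<close>; it
  is meaningful only for a nonempty family.
\<close>

definition least_card :: "'a set set \<Rightarrow> 'a rel" where
  "least_card F = |SOME A. A \<in> F \<and> (\<forall>B\<in>F. |A| \<le>o |B| )|"

lemma least_card:
  assumes "F \<noteq> {}"
  shows "\<exists>A\<in>F. least_card F = |A| \<and> (\<forall>B\<in>F. |A| \<le>o |B| )"
proof -
  have "\<exists>r\<in>card_of ` F. \<forall>r'\<in>card_of ` F. r \<le>o r'"
    using assms by (intro exists_minim_Card_order) (auto simp: card_of_Card_order)
  then have "\<exists>A. A \<in> F \<and> (\<forall>B\<in>F. |A| \<le>o |B| )"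
    by auto
  from someI_ex[OF this] show ?thesis
    unfolding least_card_def by blast
qed

definition topology_base :: "'a topology \<Rightarrow> 'a set set \<Rightarrow> bool" where
  "topology_base X \<B> \<longleftrightarrow> openin X = arbitrary union_of (\<lambda>U. U \<in> \<B>)"

lemma topology_base_iff:
  "topology_base X \<B> \<longleftrightarrow>
    (\<forall>B\<in>\<B>. openin X B) \<and>
    (\<forall>U x. openin X U \<and> x \<in> U \<longrightarrow> (\<exists>B\<in>\<B>. x \<in> B \<and> B \<subseteq> U))"
  unfolding topology_base_def openin_topology_base_unique by blast

definition weight :: "'a topology \<Rightarrow> 'a set rel" where
  "weight X = least_card {\<B>. topology_base X \<B>}"

lemma ex_topology_base: "{\<B>. topology_base X \<B>} \<noteq> {}"
proof -
  have "topology_base X {U. openin X U}"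
    unfolding topology_base_iff by blast
  then show ?thesis by blast
qed

definition splits :: "nat set \<Rightarrow> nat set \<Rightarrow> bool" where
  "splits A B \<longleftrightarrow> infinite (B \<inter> A) \<and> infinite (B - A)"

definition splitting_family :: "nat set set \<Rightarrow> bool" where
  "splitting_family \<A> \<longleftrightarrow>
    (\<forall>A\<in>\<A>. infinite A) \<and> (\<forall>B. infinite B \<longrightarrow> (\<exists>A\<in>\<A>. splits A B))"

definition splitting_number :: "nat set rel" where
  "splitting_number = least_card {\<A>. splitting_family \<A>}"

lemma ex_splitting_family: "{\<A>. splitting_family \<A>} \<noteq> {}"
proof -
  have "splitting_family {A. infinite A}"
    unfolding splitting_family_def
  proof (intro conjI allI impI)
    fix B :: "nat set"
    assume B: "infinite B"
    define e where "e = enumerate B"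
    have inj: "inj e"
      unfolding e_def using strict_mono_enumerate[OF B] strict_mono_imp_inj_on by blast
    have mem: "e n \<in> B" for n
      unfolding e_def using enumerate_in_set[OF B] .
    have inj': "inj (\<lambda>n. e (2 * n))" "inj (\<lambda>n. e (2 * n + 1))"
      by (auto intro!: injI dest!: injD[OF inj])
    have inf: "infinite (range (\<lambda>n. e (2 * n)))" "infinite (range (\<lambda>n. e (2 * n + 1)))"
      using inj'[THEN range_inj_infinite] .
    have neq: "e (2 * m + 1) \<noteq> e (2 * n)" for m n
    proof
      assume "e (2 * m + 1) = e (2 * n)"
      then have "2 * m + 1 = 2 * n"
        by (rule injD[OF inj])
      then show False by presburger
    qed
    have "splits (range (\<lambda>n. e (2 * n))) B"
      unfolding splits_def
    proof
      show "infinite (B \<inter> range (\<lambda>n. e (2 * n)))"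
        using inf(1) mem by (simp add: Int_absorb1 image_subset_iff)
      have "range (\<lambda>n. e (2 * n + 1)) \<subseteq> B - range (\<lambda>n. e (2 * n))"
        using mem neq by (simp add: image_subset_iff image_iff)
      then show "infinite (B - range (\<lambda>n. e (2 * n)))"
        using inf(2) infinite_super by blast
    qed
    then show "\<exists>A\<in>{A. infinite A}. splits A B"
      using inf(1) by blast
  qed auto
  then show ?thesis by blast
qed

definition eventually_constant :: "(nat \<Rightarrow> 'a) \<Rightarrow> bool" where
  "eventually_constant a \<longleftrightarrow> (\<exists>c. \<forall>\<^sub>F n in sequentially. a n = c)"

end

theory Submission
  imports Defs
begin

text \<open>
  Fix a base of minimal size and an injective sequence \<open>e\<close>. The traces \<open>{n. e n \<in> U}\<close> of the basic
  sets \<open>U\<close> are too few to form a splitting family, so some infinite \<open>D\<close> is split by none of them: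
  each basic \<open>U\<close> contains \<open>e n\<close> either for only finitely many or for all but finitely many
  \<open>n \<in> D\<close>. By compactness the subsequence along \<open>D\<close> has an accumulation point, and the dichotomy
  turns accumulation into convergence.
\<close>

text \<open>A family smaller than every splitting family cannot be splitting. Since
  \<open>splitting_family\<close> admits only infinite members while \<open>\<A>\<close> may contain
  finite sets, the argument is applied to the infinite members of \<open>\<A>\<close>; a finite set
  splits nothing.\<close>

lemma ex_unsplit_set:
  assumes "|\<A>| <o splitting_number"
  obtains D where "infinite D" "\<And>A. A \<in> \<A> \<Longrightarrow> \<not> splits A D"
proof -
  have "splitting_number \<le>o |\<B>|" if "splitting_family \<B>" for \<B>
    using least_card[OF ex_splitting_family] that unfolding splitting_number_def by auto
  moreover have "|{A \<in> \<A>. infinite A}| <o splitting_number"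
    using card_of_mono1[of "{A \<in> \<A>. infinite A}" \<A>] assms ordLeq_ordLess_trans by blast
  ultimately have "\<not> splitting_family {A \<in> \<A>. infinite A}"
    using not_ordLess_ordLeq by blast
  then obtain D where "infinite D" "\<forall>A\<in>\<A>. infinite A \<longrightarrow> \<not> splits A D"
    unfolding splitting_family_def by blast
  then show thesis
    using that unfolding splits_def by blast
qed

text \<open>Otherwise the open sets that contain \<open>e n\<close> for only finitely many
  \<open>n \<in> D\<close> cover the space, and a finite subcover would make \<open>D\<close>
  finite.\<close>

lemma compact_space_ex_accumulation_point:
  fixes e :: "'i \<Rightarrow> 'a"
  assumes "compact_space X" "infinite D" "e ` D \<subseteq> topspace X"
  obtains l where "l \<in> topspace X"
    "\<And>U. openin X U \<Longrightarrow> l \<in> U \<Longrightarrow> infinite {n \<in> D. e n \<in> U}"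
proof (rule ccontr)
  assume "\<not> thesis"
  define \<U> where "\<U> = {U. openin X U \<and> finite {n \<in> D. e n \<in> U}}"
  have "topspace X \<subseteq> \<Union>\<U>"
    using \<open>\<not> thesis\<close> that unfolding \<U>_def by blast
  moreover have "\<forall>U\<in>\<U>. openin X U"
    unfolding \<U>_def by blast
  ultimately obtain \<F> where \<F>: "finite \<F>" "\<F> \<subseteq> \<U>" "topspace X \<subseteq> \<Union>\<F>"
    using \<open>compact_space X\<close> unfolding compact_space_alt by meson
  have "D \<subseteq> (\<Union>U\<in>\<F>. {n \<in> D. e n \<in> U})"
    using \<F>(3) assms(3) by blast
  moreover have "finite (\<Union>U\<in>\<F>. {n \<in> D. e n \<in> U})"
    using \<F>(1,2) unfolding \<U>_def by blast
  ultimately show False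
    using \<open>infinite D\<close> finite_subset by blast
qed

lemma inj_not_eventually_constant:
  assumes "inj a"
  shows "\<not> eventually_constant a"
proof
  assume "eventually_constant a"
  then obtain c N where "\<And>n. n \<ge> N \<Longrightarrow> a n = c"
    unfolding eventually_constant_def eventually_sequentially by blast
  then have "a N = a (Suc N)"
    by simp
  then show False
    using injD[OF assms] by fastforce
qed

theorem theorem2p5p5:
  fixes X :: "'a topology"
  assumes "infinite (topspace X)"
    and "compact_space X"
    and "Hausdorff_space X"
    and "weight X <o splitting_number"
  shows "\<exists>(a :: nat \<Rightarrow> 'a) l.
    (\<forall>n. a n \<in> topspace X) \<and> \<not> eventually_constant a \<and>
    l \<in> topspace X \<and> limitin X a l sequentially"
proof -
  obtain \<B> where \<B>: "topology_base X \<B>" "weight X = |\<B>|"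
    using least_card[OF ex_topology_base] unfolding weight_def by blast
  obtain e :: "nat \<Rightarrow> 'a" where e: "inj e" "range e \<subseteq> topspace X"
    using infinite_countable_subset[OF assms(1)] by blast
  have "|(\<lambda>U. {n. e n \<in> U}) ` \<B>| <o splitting_number"
    using card_of_image assms(4) \<B>(2) ordLeq_ordLess_trans by metis
  then obtain D where D: "infinite D" "\<And>U. U \<in> \<B> \<Longrightarrow> \<not> splits {n. e n \<in> U} D"
    by (rule ex_unsplit_set) blast
  obtain l where l: "l \<in> topspace X"
    "\<And>U. openin X U \<Longrightarrow> l \<in> U \<Longrightarrow> infinite {n \<in> D. e n \<in> U}"
    using compact_space_ex_accumulation_point[OF assms(2) D(1), of e] e(2) by blast
  define d where "d = enumerate D"
  have d: "inj d" "\<And>n. d n \<in> D"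
    using strict_mono_enumerate[OF D(1)] strict_mono_imp_inj_on enumerate_in_set[OF D(1)]
    unfolding d_def by blast+
  have "limitin X (e \<circ> d) l sequentially"
    unfolding limitin_def
  proof (intro conjI allI impI)
    fix U
    assume "openin X U \<and> l \<in> U"
    then obtain B where B: "B \<in> \<B>" "l \<in> B" "B \<subseteq> U" "openin X B"
      using \<B>(1) unfolding topology_base_iff by meson
    \<comment> \<open>Accumulation at \<open>l\<close> makes one of the two pieces into which
      \<open>B\<close> cuts \<open>D\<close> infinite; as \<open>D\<close> is unsplit, the other
      piece must be finite.\<close>
    have "infinite (D \<inter> {n. e n \<in> B})"
      using l(2)[OF B(4,2)] by (simp add: Int_def)
    then have "finite (D - {n. e n \<in> B})"
      using D(2)[OF B(1)] unfolding splits_def by blast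
    \<comment> \<open>Injectivity of \<open>d\<close> carries finiteness from elements of
      \<open>D\<close> back to their positions in the enumeration, which index the
      subsequence.\<close>
    then have "finite (d -` (D - {n. e n \<in> B}))"
      using d(1) by (rule finite_vimageI)
    moreover have "{n. (e \<circ> d) n \<notin> U} \<subseteq> d -` (D - {n. e n \<in> B})"
      using d(2) B(3) by auto
    ultimately have "finite {n. (e \<circ> d) n \<notin> U}"
      using finite_subset by blast
    then show "\<forall>\<^sub>F n in sequentially. (e \<circ> d) n \<in> U"
      by (simp add: eventually_cofinite flip: cofinite_eq_sequentially)
  qed (rule l(1))
  moreover have "\<not> eventually_constant (e \<circ> d)"
    using inj_not_eventually_constant inj_compose[OF e(1) d(1)] by blast
  moreover have "\<forall>n. (e \<circ> d) n \<in> topspace X"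
    using e(2) by auto
  ultimately show ?thesis
    using l(1) by blast
qed

end
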